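(* Let $q$ be a prime power and let $g_{2,\delta}(x)=\delta x^{q^2}+x^{q^3}$ for some $\delta\in \mathbb{F}_{q^5}^*$ with $\mathrm{N}(\delta)^5 \neq 1$. Then the linear set $L_{g_{2,\delta}}$ of $\mathrm{PG}(1,q^5)$ is not $\mathrm{P\Gamma L}(2,q^5)$-equivalent to any linear set $L_{g_{1,\mu}}$, where $g_{1,\mu}(x)=\mu x^{q}+x^{q^4}$ with $\mu\in\mathbb{F}_{q^5}^*$ and $\mathrm{N}(\mu)\notin\{0,1\}$.
   Context: $\mathrm{N}(x)=x^{1+q+q^2+q^3+q^4}$ is the norm from $\mathbb{F}_{q^5}$ to $\mathbb{F}_q$. For a $q$-polynomial $f$ over $\mathbb{F}_{q^5}$, $L_f=\{\langle (x,f(x))\rangle_{\mathbb{F}_{q^5}} : x\in\mathbb{F}_{q^5}^*\}\subseteq\mathrm{PG}(1,q^5)$. Two point sets of $\mathrm{PG}(1,q^5)$ are $\mathrm{P\Gamma L}(2,q^5)$-equivalent if some element of $\mathrm{P\Gamma L}(2,q^5)$ maps one onto the other. *)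

theory Defs
  imports "HOL-Analysis.Analysis" "HOL-Number_Theory.Number_Theory"
begin

definition normq :: "nat \<Rightarrow> 'a::field \<Rightarrow> 'a" where
  "normq q x = x ^ (1 + q + q ^ 2 + q ^ 3 + q ^ 4)"

definition g1 :: "nat \<Rightarrow> 'a::field \<Rightarrow> 'a \<Rightarrow> 'a" where
  "g1 q \<mu> x = \<mu> * x ^ q + x ^ (q ^ 4)"

definition g2 :: "nat \<Rightarrow> 'a::field \<Rightarrow> 'a \<Rightarrow> 'a" where
  "g2 q \<delta> x = \<delta> * x ^ (q ^ 2) + x ^ (q ^ 3)"

definition proj_points :: "('a::field ^ 'n) set set" where
  "proj_points = {vec.span {v} |v. v \<noteq> 0}"

text \<open>The set \<open>L\<^sub>f\<close>; it is meant for \<open>f\<close> a \<open>q\<close>-polynomial function, but depends on \<open>f\<close>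
  only through its values.\<close>

definition linear_set :: "('a::field \<Rightarrow> 'a) \<Rightarrow> ('a ^ 2) set set" where
  "linear_set f = {vec.span {vector [x, f x]} |x. x \<noteq> 0}"

definition field_automorphism :: "('a::field \<Rightarrow> 'a) \<Rightarrow> bool" where
  "field_automorphism \<sigma> \<longleftrightarrow>
     bij \<sigma> \<and> (\<forall>x y. \<sigma> (x + y) = \<sigma> x + \<sigma> y) \<and> (\<forall>x y. \<sigma> (x * y) = \<sigma> x * \<sigma> y)"

definition GammaL :: "('a::field ^ 'n \<Rightarrow> 'a ^ 'n) set" where
  "GammaL = {T. bij T \<and> (\<forall>u v. T (u + v) = T u + T v) \<and>
     (\<exists>\<sigma>. field_automorphism \<sigma> \<and> (\<forall>c v. T (c *s v) = \<sigma> c *s T v))}"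

text \<open>Collineations are represented extensionally: their value outside the point set is
  \<^const>\<open>undefined\<close>, so that distinct members of this set are distinct permutations of the points.\<close>

definition PGammaL :: "(('a::field ^ 'n) set \<Rightarrow> ('a ^ 'n) set) set" where
  "PGammaL = (\<lambda>T. restrict ((`) T) proj_points) ` GammaL"

definition PGammaL_equivalent :: "('a::field ^ 'n) set set \<Rightarrow> ('a ^ 'n) set set \<Rightarrow> bool" where
  "PGammaL_equivalent X Y \<longleftrightarrow> (\<exists>\<phi>\<in>PGammaL. \<phi> ` X = Y)"

end

theory Submission
  imports Defs "HOL-Combinatorics.Cycles"
begin

text \<open>An equivalence turns \<open>L\<^sub>g\<close>, \<open>g = g\<^sub>1\<close>, into \<open>{\<langle>(u(x), v(x))\<rangle>}\<close> with \<open>u = \<alpha>x + \<beta>g(x)\<close> and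
  \<open>v = \<gamma>x + \<xi>g(x)\<close>. If this is \<open>L\<close> of \<open>g\<^sub>2\<close>, then \<open>u\<close> is bijective and \<open>f = v \<circ> u\<^sup>-\<^sup>1 = \<Sum> a\<^sub>i x\<^bsup>q^i\<^esup>\<close> satisfies
  \<open>L\<^sub>f = L\<close> of \<open>g\<^sub>2\<close>. All fibres of \<open>x \<mapsto> f(x)/x\<close> have size \<open>-1\<close> in the field, so the moments
  \<open>\<Sum>\<^sub>x \<Prod>\<^sub>j\<^sub>\<in>\<^sub>S (f(x)/x)\<^bsup>q^j\<^esup>\<close>, which are permanents in the \<open>a\<^sub>i\<close>, depend on \<open>L\<^sub>f\<close> only. They force
  \<open>f = a\<^sub>2 x\<^bsup>q^2\<^esup> + a\<^sub>3 x\<^bsup>q^3\<^esup>\<close> with \<open>N(a\<^sub>2) N(a\<^sub>3) = N(\<delta>)\<close> and one of the two norms equal to \<open>1\<close>. Comparing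
  coefficients in \<open>f \<circ> u = v\<close> gives \<open>N(\<mu>)^5 = 1\<close> and \<open>N(a\<^sub>2) = N(\<mu>)^2 N(a\<^sub>3)\<close> (for the conjugate of \<open>\<mu>\<close>),
  hence \<open>N(\<delta>)^5 = 1\<close>.\<close>

section \<open>Base-q digits and residues modulo \<open>q ^ n - 1\<close>\<close>

lemma digit_sum_unique:
  fixes q :: nat
  assumes "\<And>i. i < n \<Longrightarrow> c i < q" "\<And>i. i < n \<Longrightarrow> d i < q"
    and "(\<Sum>i<n. c i * q ^ i) = (\<Sum>i<n. d i * q ^ i)" and "i < n"
  shows "c i = d i"
  using assms
proof (induction n arbitrary: c d i)
  case 0
  then show ?case by simp
next
  case (Suc n)
  have split: "(\<Sum>i<Suc n. c i * q ^ i) = c 0 + q * (\<Sum>i<n. c (Suc i) * q ^ i)" for c :: "nat \<Rightarrow> nat"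
    unfolding sum.lessThan_Suc_shift by (simp add: sum_distrib_left mult_ac)
  have eq: "c 0 + q * (\<Sum>i<n. c (Suc i) * q ^ i) = d 0 + q * (\<Sum>i<n. d (Suc i) * q ^ i)"
    using Suc.prems(3) unfolding split .
  have lt: "c 0 < q" "d 0 < q"
    using Suc.prems(1,2)[of 0] by auto
  have "(c 0 + q * (\<Sum>i<n. c (Suc i) * q ^ i)) mod q = c 0"
    "(d 0 + q * (\<Sum>i<n. d (Suc i) * q ^ i)) mod q = d 0"
    using lt by simp_all
  then have 0: "c 0 = d 0"
    using eq by simp
  then have "(\<Sum>i<n. c (Suc i) * q ^ i) = (\<Sum>i<n. d (Suc i) * q ^ i)"
    using eq lt by simp
  then have "c (Suc i) = d (Suc i)" if "i < n" for i
    using Suc.IH[of "\<lambda>i. c (Suc i)" "\<lambda>i. d (Suc i)" i] Suc.prems(1,2) that by simp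
  then show ?case
    using 0 Suc.prems(4) by (cases i) auto
qed

lemma digit_sum_less:
  fixes q :: nat
  assumes "\<And>i. i < n \<Longrightarrow> c i < q"
  shows "(\<Sum>i<n. c i * q ^ i) < q ^ n"
  using assms
proof (induction n)
  case (Suc n)
  have "(\<Sum>i<n. c i * q ^ i) + c n * q ^ n < q ^ n + c n * q ^ n"
    using Suc by simp
  also have "\<dots> = Suc (c n) * q ^ n" by simp
  also have "\<dots> \<le> q * q ^ n"
    using Suc.prems[of n] by (intro mult_right_mono) auto
  finally show ?case by simp
qed simp

lemma sum_mset_lessThan_eq_sum_count:
  fixes f :: "nat \<Rightarrow> nat"
  assumes "set_mset M \<subseteq> {..<n}"
  shows "(\<Sum>i\<in>#M. f i) = (\<Sum>i<n. count M i * f i)"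
  using assms
proof (induction M)
  case (add x M)
  have "(\<Sum>i<n. count (add_mset x M) i * f i) = (\<Sum>i<n. count M i * f i + (if i = x then f i else 0))"
    by (intro sum.cong) auto
  then show ?case
    using add by (simp add: sum.distrib)
qed simp

text \<open>While some digit is at least \<open>q\<close>, carrying cyclically preserves the residue and decreases the
  number of terms.\<close>

lemma power_sum_cong_imp_eq_mset_set:
  fixes q :: nat
  assumes "2 \<le> q" "M \<noteq> {#}" "set_mset M \<subseteq> {..<n}" "S \<noteq> {}" "S \<subseteq> {..<n}" "size M \<le> card S"
    and "[(\<Sum>i\<in>#M. q ^ i) = (\<Sum>i\<in>S. q ^ i)] (mod q ^ n - 1)"
  shows "M = mset_set S"
  using assms(2,3,6,7)
proof (induction "size M" arbitrary: M rule: less_induct)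
  case less
  have n: "0 < n" using assms by (cases n) auto
  have fS: "finite S" using assms(5) finite_subset by blast
  show ?case
  proof (cases "\<exists>i. q \<le> count M i")
    case True
    then obtain i where i: "q \<le> count M i" by blast
    with assms(1) have "0 < count M i" by linarith
    then have "i \<in># M" by simp
    with less.prems have "i < n" by auto
    from i obtain M' where M: "M = replicate_mset q i + M'"
      by (metis count_le_replicate_mset_subset_eq subset_mset.add_diff_inverse)
    define N where "N = add_mset (Suc i mod n) M'"
    have size: "size N < size M"
      using assms(1) by (simp add: M N_def)
    have "[q ^ (Suc i mod n) = q ^ Suc i] (mod q ^ n - 1)"
    proof (cases "Suc i = n")
      case True
      have "q ^ n = 1 + (q ^ n - 1)" using assms(1) by simp
      then have "[1 = q ^ n] (mod q ^ n - 1)"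
        unfolding cong_def by (metis mod_add_self2)
      then show ?thesis using True by simp
    next
      case False
      then have "Suc i < n" using \<open>i < n\<close> by simp
      then show ?thesis by simp
    qed
    then have "[(\<Sum>i\<in>#N. q ^ i) = (\<Sum>i\<in>#M. q ^ i)] (mod q ^ n - 1)"
      by (simp add: N_def M cong_add)
    then have cong: "[(\<Sum>i\<in>#N. q ^ i) = (\<Sum>i\<in>S. q ^ i)] (mod q ^ n - 1)"
      using less.prems cong_trans by blast
    \<comment> \<open>Here lies the contradiction: \<open>N\<close> would have \<open>card S\<close>
      elements, but it is smaller than \<open>M\<close>, whose size is at most
      \<open>card S\<close>. Hence no digit can reach q.\<close>
    have "N = mset_set S"
      using less.prems n size cong by (intro less.hyps) (auto simp: N_def M)
    then have "size N = card S" by simp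
    then show ?thesis using size less.prems by simp
  next
    case False
    then have small: "count M i < q" for i using not_le by blast
    have small': "count (mset_set S) i < q" for i
      using assms(1) by (simp add: count_mset_set')
    have eqM: "(\<Sum>i\<in>#M. q ^ i) = (\<Sum>i<n. count M i * q ^ i)"
      using less.prems by (intro sum_mset_lessThan_eq_sum_count)
    have eqS: "(\<Sum>i\<in>S. q ^ i) = (\<Sum>i<n. count (mset_set S) i * q ^ i)"
      using sum_mset_lessThan_eq_sum_count[of "mset_set S" n "\<lambda>i. q ^ i"] assms(5) fS
      by (simp add: sum_unfold_sum_mset)
    have bounds: "0 < (\<Sum>i\<in>#M. q ^ i)" "0 < (\<Sum>i\<in>S. q ^ i)"
      "(\<Sum>i\<in>#M. q ^ i) \<le> q ^ n - 1" "(\<Sum>i\<in>S. q ^ i) \<le> q ^ n - 1"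
    proof -
      show "0 < (\<Sum>i\<in>#M. q ^ i)"
        using less.prems(1) assms(1) by (induction M) auto
      show "0 < (\<Sum>i\<in>S. q ^ i)"
        using assms(1,4) fS by (intro sum_pos) auto
      show "(\<Sum>i\<in>#M. q ^ i) \<le> q ^ n - 1"
        unfolding eqM using digit_sum_less[of n "count M" q] small by fastforce
      show "(\<Sum>i\<in>S. q ^ i) \<le> q ^ n - 1"
        unfolding eqS using digit_sum_less[of n "count (mset_set S)" q] small' by fastforce
    qed
    \<comment> \<open>The residues are taken from 1 to k instead of 0 to k - 1, because a sum may
      equal \<open>q ^ n - 1\<close> itself, as happens for q = 2 and S = \<open>{..<n}\<close>.
      Positivity excludes the competing representative 0.\<close>
    have unique: "x = y" if "[x = y] (mod k)" "0 < x" "0 < y" "x \<le> k" "y \<le> k" for x y k :: nat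
      using that by (cases "x = k"; cases "y = k") (auto simp: cong_def)
    have "(\<Sum>i\<in>#M. q ^ i) = (\<Sum>i\<in>S. q ^ i)"
      using unique[OF less.prems(4)] bounds by blast
    then have eq: "(\<Sum>i<n. count M i * q ^ i) = (\<Sum>i<n. count (mset_set S) i * q ^ i)"
      unfolding eqM eqS .
    show ?thesis
    proof (rule multiset_eqI)
      fix i
      show "count M i = count (mset_set S) i"
      proof (cases "i < n")
        case True
        then show ?thesis
          using digit_sum_unique[of n "count M" q "count (mset_set S)" i] small small' eq by blast
      next
        case False
        then show ?thesis
          using less.prems(2) assms(5) by (metis count_mset_set(3) count_inI lessThan_iff subsetD)
      qed
    qed
  qed
qed

text \<open>A priori \<open>f\<close> may repeat values on \<open>S\<close>, so the multiset of its
  values is compared with \<open>S\<close>. This later singles out the permutations among all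
  exponent choices in an expanded product.\<close>

lemma power_sum_cong_imp_image_eq:
  fixes q :: nat
  assumes "2 \<le> q" "S \<noteq> {}" "S \<subseteq> {..<n}" "f ` S \<subseteq> {..<n}"
    and "[(\<Sum>i\<in>S. q ^ f i) = (\<Sum>i\<in>S. q ^ i)] (mod q ^ n - 1)"
  shows "f ` S = S"
proof -
  have "finite S" using assms(3) finite_subset by blast
  then have "image_mset f (mset_set S) = mset_set S"
    using assms
    by (intro power_sum_cong_imp_eq_mset_set[of q _ n])
      (auto simp: mset_set_empty_iff image_mset.compositionality comp_def simp flip: sum_unfold_sum_mset)
  then have "set_mset (image_mset f (mset_set S)) = set_mset (mset_set S)" by simp
  with \<open>finite S\<close> show ?thesis by simp
qed

section \<open>Fibre sizes of x -> f(x)/x, read in the field\<close>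

text \<open>Translation by \<open>w\<close> permutes the finite set \<open>W\<close>, so it
  preserves the sum of the elements of \<open>W\<close>; yet it changes that sum by
  \<open>card W\<close> times \<open>w\<close>.\<close>

lemma of_nat_card_eq_0_if_translation_closed:
  fixes W :: "'a::idom set"
  assumes "finite W" "w \<noteq> 0" "\<And>y. y \<in> W \<Longrightarrow> w + y \<in> W"
  shows "of_nat (card W) = (0::'a)"
proof -
  have inj: "inj_on ((+) w) W" by simp
  have "(+) w ` W = W"
    using assms(1,3) inj by (intro endo_inj_surj) auto
  then have "(\<Sum>y\<in>W. y) = (\<Sum>y\<in>W. w + y)"
    using sum.reindex[OF inj, of "\<lambda>y. y"] by simp
  then have "of_nat (card W) * w = 0"
    by (simp add: sum.distrib)
  then show ?thesis using assms(2) by simp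
qed

text \<open>A fibre together with \<open>0\<close> is an additive subgroup, so the size of each fibre is \<open>-1\<close> in the field.\<close>

lemma sum_quotients_eq:
  fixes f :: "'a::finite_field \<Rightarrow> 'a" and h :: "'a \<Rightarrow> 'a"
  assumes additive: "\<And>x y. f (x + y) = f x + f y"
  shows "(\<Sum>x\<in>-{0}. h (f x / x)) = - (\<Sum>z\<in>(\<lambda>x. f x / x) ` (-{0}). h z)"
proof -
  have fibre: "of_nat (card {x \<in> -{0}. f x / x = z}) = (-1::'a)"
    if z: "z \<in> (\<lambda>x. f x / x) ` (-{0})" for z
  proof -
    obtain w where w: "w \<noteq> 0" "z = f w / w" using z by auto
    define V where "V = {x \<in> -{0}. f x / x = z}"
    have zw: "z * w = f w" using w by simp
    have "f 0 = 0" using additive[of 0 0] by (metis add_0 add_cancel_right_right)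
    then have V: "insert 0 V = {x. f x = z * x}" by (auto simp: V_def field_simps)
    have "of_nat (card (insert 0 V)) = (0::'a)"
      unfolding V by (rule of_nat_card_eq_0_if_translation_closed[OF _ w(1)])
        (auto simp: additive distrib_left zw)
    moreover have "0 \<notin> V" by (simp add: V_def)
    ultimately have "1 + of_nat (card V) = (0::'a)" by simp
    then show ?thesis unfolding V_def by (simp add: eq_neg_iff_add_eq_0 add.commute)
  qed
  have "(\<Sum>x\<in>-{0}. h (f x / x)) =
      (\<Sum>z\<in>(\<lambda>x. f x / x) ` (-{0}). \<Sum>x\<in>{x \<in> -{0}. f x / x = z}. h (f x / x))"
    by (rule sum.image_gen) simp
  also have "\<dots> = (\<Sum>z\<in>(\<lambda>x. f x / x) ` (-{0}). of_nat (card {x \<in> -{0}. f x / x = z}) * h z)"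
    by (intro sum.cong refl) simp
  also have "\<dots> = (\<Sum>z\<in>(\<lambda>x. f x / x) ` (-{0}). - h z)"
    by (intro sum.cong refl) (simp only: fibre mult_minus_left mult_1)
  finally show ?thesis by (simp add: sum_negf)
qed

section \<open>q-polynomials and power sums over a field with \<open>q ^ n\<close> elements\<close>

text \<open>These are the q-polynomials of q-degree below n. Over a field with \<open>q ^ n\<close>
  elements every q-polynomial function has this form, since there x ^ (q ^ n) = x.\<close>

definition linearized :: "nat \<Rightarrow> nat \<Rightarrow> (nat \<Rightarrow> 'a::field) \<Rightarrow> 'a \<Rightarrow> 'a" where
  "linearized q n a x = (\<Sum>i<n. a i * x ^ q ^ i)"

locale finite_extension =
  fixes q n :: nat and ty :: "'a::finite_field itself"
  assumes primepow: "primepow q" and card_UNIV: "CARD('a) = q ^ n"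
begin

lemma q_ge_2: "2 \<le> q"
  using primepow_gt_Suc_0[OF primepow] by simp

lemma n_pos: "0 < n"
proof -
  have "1 < CARD('a)"
    using card_mono[of UNIV "{0, 1::'a}"] by simp
  then show ?thesis unfolding card_UNIV by (cases n) auto
qed

lemma prime_CHAR: "prime CHAR('a)"
  using prime_CHAR_semidom finite_imp_CHAR_pos[where ?'a = 'a] by simp

text \<open>The characteristic divides the field size, a power of the prime below q, so it is that
  prime. This form makes the additivity of Frobenius powers applicable.\<close>

lemma q_power_eq_CHAR_power: "\<exists>k. q ^ i = CHAR('a) ^ k"
proof -
  obtain p k where p: "prime p" "q = p ^ k"
    using primepow by (auto simp: primepow_def)
  have "of_nat (CARD('a)) = (0::'a)"
    by (rule of_nat_card_eq_0_if_translation_closed[of _ 1]) auto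
  then have "CHAR('a) dvd p ^ (k * n)"
    by (simp add: of_nat_eq_0_iff_char_dvd card_UNIV p(2) power_mult flip: of_nat_power)
  then have "CHAR('a) = p"
    using prime_CHAR p(1) prime_dvd_power primes_dvd_imp_eq by blast
  then show ?thesis using p(2) by (metis power_mult)
qed

lemma add_power_q: "(x + y :: 'a) ^ q ^ i = x ^ q ^ i + y ^ q ^ i"
  using q_power_eq_CHAR_power[of i] freshmans_dream'[OF prime_CHAR] by blast

lemma sum_power_q: "(sum f A :: 'a) ^ q ^ i = (\<Sum>x\<in>A. f x ^ q ^ i)"
  using q_power_eq_CHAR_power[of i] freshmans_dream_sum'[OF prime_CHAR] by blast

lemma power_q_add: "(x :: 'a) ^ q ^ (i + n) = x ^ q ^ i"
  using finite_field_power_card_eq_same[of "x ^ q ^ i"]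
  by (simp add: card_UNIV power_add flip: power_mult)

lemma power_q_mod: "(x :: 'a) ^ q ^ (i mod n) = x ^ q ^ i"
proof -
  have "x ^ q ^ (i + k * n) = x ^ q ^ i" for i k
  proof (induction k)
    case (Suc k)
    then show ?case using power_q_add[of x "i + k * n"] by (simp add: algebra_simps)
  qed simp
  from this[of "i mod n" "i div n"] show ?thesis by simp
qed

lemma power_q_power_q: "((x :: 'a) ^ q ^ i) ^ q ^ j = x ^ q ^ ((i + j) mod n)"
  by (simp add: power_q_mod power_add flip: power_mult)

lemma power_card_minus_1: "(x :: 'a) \<noteq> 0 \<Longrightarrow> x ^ (q ^ n - 1) = 1"
  using finite_field_power_card_eq_same[of x] q_ge_2
  by (simp add: card_UNIV power_diff)

lemma power_mod_card:
  assumes "(x :: 'a) \<noteq> 0"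
  shows "x ^ (k mod (q ^ n - 1)) = x ^ k"
proof -
  have "x ^ k = x ^ ((q ^ n - 1) * (k div (q ^ n - 1)) + k mod (q ^ n - 1))"
    by (simp only: mult_div_mod_eq)
  also have "\<dots> = x ^ (k mod (q ^ n - 1))"
    by (simp only: power_add power_mult power_card_minus_1[OF assms] power_one mult_1)
  finally show ?thesis by simp
qed

text \<open>Orthogonality of characters of the multiplicative group. For congruent exponents all
  \<open>q ^ n - 1\<close> terms are 1. Otherwise some y has y ^ k \<noteq> y ^ l, and substituting
  y * x for x multiplies the sum by a factor other than 1.\<close>

lemma sum_power_quotient:
  "(\<Sum>x\<in>-{0}. x ^ k / x ^ l) = (if [k = l] (mod q ^ n - 1) then -1 else (0::'a))"
proof (cases "[k = l] (mod q ^ n - 1)")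
  case True
  then have "x ^ k / x ^ l = 1" if "x \<noteq> 0" for x :: 'a
    using that power_mod_card[of x k] power_mod_card[of x l] by (simp add: cong_def)
  then have "(\<Sum>x\<in>-{0}. x ^ k / x ^ l) = (\<Sum>x\<in>-{0::'a}. 1 :: 'a)"
    by (intro sum.cong) auto
  also have "\<dots> = of_nat (card (-{0::'a}))" by simp
  also have "card (-{0::'a}) = CARD('a) - 1"
    by (simp add: Compl_eq_Diff_UNIV card_Diff_subset)
  also have "of_nat \<dots> = (of_nat CARD('a) - 1 :: 'a)"
    using card_UNIV q_ge_2 by (simp add: of_nat_diff)
  also have "of_nat CARD('a) = (0::'a)"
    by (rule of_nat_card_eq_0_if_translation_closed[of _ 1]) auto
  finally show ?thesis using True by simp
next
  case False
  define k' l' where "k' = k mod (q ^ n - 1)" and "l' = l mod (q ^ n - 1)"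
  have "1 < CARD('a)"
    using card_mono[of UNIV "{0, 1::'a}"] by simp
  then have pos: "0 < q ^ n - 1" unfolding card_UNIV by simp
  then have less: "k' < q ^ n - 1" "l' < q ^ n - 1" by (simp_all add: k'_def l'_def)
  have "\<exists>y::'a. y \<noteq> 0 \<and> y ^ k \<noteq> y ^ l"
  proof (rule ccontr)
    assume "\<not> (\<exists>y::'a. y \<noteq> 0 \<and> y ^ k \<noteq> y ^ l)"
    then have eq: "y ^ k' = y ^ l'" if "y \<noteq> 0" for y :: 'a
      using that by (auto simp: k'_def l'_def power_mod_card simp del: One_nat_def)
    \<comment> \<open>If no such y existed, this nonzero polynomial of degree below
      \<open>q ^ n - 1\<close> would vanish at all nonzero field elements.\<close>
    define P where "P = Polynomial.monom 1 k' - Polynomial.monom (1::'a) l'"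
    have "Polynomial.coeff P k' \<noteq> 0"
      using False by (simp add: P_def k'_def l'_def cong_def)
    then have "P \<noteq> 0" by auto
    then have "card {x. poly P x = 0} \<le> Polynomial.degree P" by (rule card_poly_roots_bound)
    moreover have "Polynomial.degree P < q ^ n - 1"
      unfolding P_def using less
      by (intro le_less_trans[OF degree_diff_le_max]) (simp add: degree_monom_eq)
    moreover have "card (-{0::'a}) \<le> card {x. poly P x = 0}"
      using eq by (intro card_mono) (auto simp: P_def poly_monom)
    moreover have "card (-{0::'a}) = q ^ n - 1"
      by (simp add: Compl_eq_Diff_UNIV card_Diff_subset card_UNIV)
    ultimately show False by linarith
  qed
  then obtain y :: 'a where y: "y \<noteq> 0" "y ^ k \<noteq> y ^ l" by blast
  have "(\<Sum>x\<in>-{0}. x ^ k / x ^ l) = (\<Sum>x\<in>-{0}. (y * x) ^ k / (y * x) ^ l)"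
    by (rule sum.reindex_bij_witness[of _ "\<lambda>x. y * x" "\<lambda>x. x / y"]) (use y in auto)
  also have "\<dots> = y ^ k / y ^ l * (\<Sum>x\<in>-{0}. x ^ k / x ^ l)"
    by (simp add: power_mult_distrib sum_distrib_left)
  finally have "(y ^ k / y ^ l - 1) * (\<Sum>x\<in>-{0}. x ^ k / x ^ l) = 0"
    by (simp add: algebra_simps)
  then show ?thesis using y False by simp
qed

lemma linearized_add: "linearized q n a (x + y :: 'a) = linearized q n a x + linearized q n a y"
  by (simp add: linearized_def add_power_q distrib_left sum.distrib)

text \<open>Frobenius shifts the coefficients cyclically by j and conjugates them: this is row j of
  the Dickson matrix of \<open>a\<close>. Adding n before subtracting j keeps the natural
  subtraction from truncating.\<close>

lemma linearized_power_q:
  fixes x :: 'a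
  assumes "j < n"
  shows "linearized q n a x ^ q ^ j = (\<Sum>m<n. a ((m + n - j) mod n) ^ q ^ j * x ^ q ^ m)"
proof -
  have l: "((i + j) mod n + n - j) mod n = i" if "i < n" for i
  proof -
    have "(i + j) mod n + n - j = (i + j) mod n + (n - j)" using assms by simp
    also have "\<dots> mod n = (i + j + (n - j)) mod n" by (rule mod_add_left_eq)
    also have "\<dots> = i" using assms that by simp
    finally show ?thesis .
  qed
  have r: "((m + n - j) mod n + j) mod n = m" if "m < n" for m
    using assms that by (simp add: mod_add_left_eq)
  have "linearized q n a x ^ q ^ j = (\<Sum>i<n. a i ^ q ^ j * x ^ q ^ ((i + j) mod n))"
    by (simp add: linearized_def sum_power_q power_mult_distrib power_q_power_q)
  also have "\<dots> = (\<Sum>m<n. a ((m + n - j) mod n) ^ q ^ j * x ^ q ^ m)"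
    by (rule sum.reindex_bij_witness[of _ "\<lambda>m. (m + n - j) mod n" "\<lambda>i. (i + j) mod n"])
      (use n_pos l r in auto)
  finally show ?thesis .
qed

section \<open>Moments of the quotients as permanents\<close>

text \<open>Multiplying out gives one term for each choice of an exponent index \<pi>(j) for every j
  in S. Summation over x kills the term unless the sums of q ^ \<pi>(j) and of q ^ j are congruent,
  which means that \<pi> permutes S. What remains is the permanent of the principal submatrix of the
  Dickson matrix on S, negated.\<close>

lemma sum_prod_power_quotients:
  fixes a :: "nat \<Rightarrow> 'a"
  assumes "S \<subseteq> {..<n}" "S \<noteq> {}"
  shows "(\<Sum>x\<in>-{0}. \<Prod>j\<in>S. (linearized q n a x / x) ^ q ^ j) =
    - (\<Sum>\<pi> | \<pi> permutes S. \<Prod>j\<in>S. a ((\<pi> j + n - j) mod n) ^ q ^ j)"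
proof -
  have fin: "finite S" using assms(1) finite_subset by blast
  define A where "A j m = a ((m + n - j) mod n) ^ q ^ j" for j m
  define P where "P = (S \<rightarrow>\<^sub>E {..<n})"
  have "finite P" using fin by (simp add: P_def finite_PiE)
  have "(\<Prod>j\<in>S. (linearized q n a x / x) ^ q ^ j) =
      (\<Sum>\<pi>\<in>P. (\<Prod>j\<in>S. A j (\<pi> j)) * (x ^ (\<Sum>j\<in>S. q ^ \<pi> j) / x ^ (\<Sum>j\<in>S. q ^ j)))" for x
  proof -
    have "(\<Prod>j\<in>S. (linearized q n a x / x) ^ q ^ j) =
        (\<Prod>j\<in>S. \<Sum>m<n. A j m * (x ^ q ^ m / x ^ q ^ j))"
      using assms(1) by (intro prod.cong refl)
        (auto simp: power_divide linearized_power_q A_def sum_divide_distrib)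
    also have "\<dots> = (\<Sum>\<pi>\<in>P. \<Prod>j\<in>S. A j (\<pi> j) * (x ^ q ^ \<pi> j / x ^ q ^ j))"
      unfolding P_def using fin by (intro prod_sum_PiE) auto
    finally show ?thesis by (simp add: prod.distrib prod_dividef power_sum)
  qed
  then have "(\<Sum>x\<in>-{0}. \<Prod>j\<in>S. (linearized q n a x / x) ^ q ^ j) =
      (\<Sum>\<pi>\<in>P. \<Sum>x\<in>-{0}. (\<Prod>j\<in>S. A j (\<pi> j)) * (x ^ (\<Sum>j\<in>S. q ^ \<pi> j) / x ^ (\<Sum>j\<in>S. q ^ j)))"
    by (simp add: sum.swap[of _ P])
  also have "\<dots> = (\<Sum>\<pi>\<in>P. (\<Prod>j\<in>S. A j (\<pi> j)) *
      (if [(\<Sum>j\<in>S. q ^ \<pi> j) = (\<Sum>j\<in>S. q ^ j)] (mod q ^ n - 1) then -1 else 0))"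
    by (simp only: sum_power_quotient flip: sum_distrib_left)
  also have "\<dots> = (\<Sum>\<pi>\<in>P. if \<pi> ` S = S then - (\<Prod>j\<in>S. A j (\<pi> j)) else 0)"
  proof (intro sum.cong refl)
    fix \<pi> assume "\<pi> \<in> P"
    then have "\<pi> ` S \<subseteq> {..<n}" by (auto simp: P_def)
    then have "[(\<Sum>j\<in>S. q ^ \<pi> j) = (\<Sum>j\<in>S. q ^ j)] (mod q ^ n - 1) \<longleftrightarrow> \<pi> ` S = S"
    proof (intro iffI)
      assume "\<pi> ` S = S"
      then have "inj_on \<pi> S" using fin by (simp add: finite_surj_inj)
      then have "(\<Sum>j\<in>\<pi> ` S. q ^ j) = (\<Sum>j\<in>S. q ^ \<pi> j)" by (simp add: sum.reindex)
      with \<open>\<pi> ` S = S\<close> show "[(\<Sum>j\<in>S. q ^ \<pi> j) = (\<Sum>j\<in>S. q ^ j)] (mod q ^ n - 1)" by simp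
    qed (use assms q_ge_2 power_sum_cong_imp_image_eq in blast)
    then show "(\<Prod>j\<in>S. A j (\<pi> j)) *
        (if [(\<Sum>j\<in>S. q ^ \<pi> j) = (\<Sum>j\<in>S. q ^ j)] (mod q ^ n - 1) then -1 else 0) =
        (if \<pi> ` S = S then - (\<Prod>j\<in>S. A j (\<pi> j)) else 0)" by simp
  qed
  also have "\<dots> = - (\<Sum>\<pi> | \<pi> \<in> P \<and> \<pi> ` S = S. \<Prod>j\<in>S. A j (\<pi> j))"
    using \<open>finite P\<close> by (simp add: sum.If_cases sum_negf Collect_conj_eq Int_commute)
  also have "(\<Sum>\<pi> | \<pi> \<in> P \<and> \<pi> ` S = S. \<Prod>j\<in>S. A j (\<pi> j)) =
      (\<Sum>\<pi> | \<pi> permutes S. \<Prod>j\<in>S. A j (\<pi> j))"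
  \<comment> \<open>The expansion ranges over functions that are \<open>undefined\<close> outside
    \<open>S\<close>, whereas \<open>permutes\<close> asks for the identity there; the two maps
    translate between these conventions.\<close>
  proof (rule sum.reindex_bij_witness[of _ "\<lambda>\<pi>. restrict \<pi> S" "\<lambda>\<pi> j. if j \<in> S then \<pi> j else j"])
    fix \<pi> assume \<pi>: "\<pi> \<in> {\<pi>. \<pi> \<in> P \<and> \<pi> ` S = S}"
    then show "restrict (\<lambda>j. if j \<in> S then \<pi> j else j) S = \<pi>"
      by (auto simp: P_def fun_eq_iff PiE_iff extensional_def)
    have "bij_betw \<pi> S S"
      using \<pi> fin by (simp add: bij_betw_def finite_surj_inj)
    then have "bij_betw (\<lambda>j. if j \<in> S then \<pi> j else j) S S"
      by (rule bij_betw_cong[THEN iffD1, rotated]) simp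
    then show "(\<lambda>j. if j \<in> S then \<pi> j else j) \<in> {\<pi>. \<pi> permutes S}"
      by (auto intro: bij_imp_permutes)
    show "(\<Prod>j\<in>S. A j (if j \<in> S then \<pi> j else j)) = (\<Prod>j\<in>S. A j (\<pi> j))"
      by (intro prod.cong) auto
  next
    fix \<pi> assume "\<pi> \<in> {\<pi>. \<pi> permutes S}"
    then have \<pi>: "\<pi> permutes S" by simp
    then show "(\<lambda>j. if j \<in> S then restrict \<pi> S j else j) = \<pi>"
      by (auto simp: fun_eq_iff permutes_def)
    show "restrict \<pi> S \<in> {\<pi>. \<pi> \<in> P \<and> \<pi> ` S = S}"
      using permutes_image[OF \<pi>] assms(1) by (auto simp: P_def)
  qed
  finally show ?thesis by (simp add: A_def)
qed

text \<open>Each moment is minus the sum of a fixed function over the set of quotients, so equal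
  sets have equal moments.\<close>

lemma sum_permutes_eq_if_quotients_eq:
  fixes a b :: "nat \<Rightarrow> 'a"
  assumes "(\<lambda>x. linearized q n a x / x) ` (-{0}) = (\<lambda>x. linearized q n b x / x) ` (-{0})"
    and "S \<subseteq> {..<n}" "S \<noteq> {}"
  shows "(\<Sum>\<pi> | \<pi> permutes S. \<Prod>j\<in>S. a ((\<pi> j + n - j) mod n) ^ q ^ j) =
    (\<Sum>\<pi> | \<pi> permutes S. \<Prod>j\<in>S. b ((\<pi> j + n - j) mod n) ^ q ^ j)"
  using sum_prod_power_quotients[OF assms(2,3), of a] sum_prod_power_quotients[OF assms(2,3), of b]
    sum_quotients_eq[of "linearized q n a" "\<lambda>z. \<Prod>j\<in>S. z ^ q ^ j", OF linearized_add]
    sum_quotients_eq[of "linearized q n b" "\<lambda>z. \<Prod>j\<in>S. z ^ q ^ j", OF linearized_add]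
  by (simp add: assms(1))

text \<open>Dividing by x ^ (q ^ i) and summing over x \<noteq> 0 isolates the coefficient
  \<open>a i\<close>, up to sign.\<close>

lemma linearized_zero_imp_coeff_zero:
  fixes a :: "nat \<Rightarrow> 'a"
  assumes "\<And>x. linearized q n a x = 0" "i < n"
  shows "a i = 0"
proof -
  have "[q ^ m = q ^ i] (mod q ^ n - 1) \<longleftrightarrow> m = i" if "m < n" for m
    using power_sum_cong_imp_image_eq[of q "{i}" n "\<lambda>_. m"] that assms(2) q_ge_2 by auto
  then have "(\<Sum>m<n. a m * (\<Sum>x\<in>-{0}. x ^ q ^ m / x ^ q ^ i)) = (\<Sum>m<n. if m = i then - a m else 0)"
    by (intro sum.cong refl) (simp add: sum_power_quotient)
  moreover have "(\<Sum>m<n. a m * (\<Sum>x\<in>-{0}. x ^ q ^ m / x ^ q ^ i)) =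
      (\<Sum>x\<in>-{0}. linearized q n a x / x ^ q ^ i)"
    by (simp add: sum_distrib_left sum.swap[of _ "-{0}"] linearized_def sum_divide_distrib)
  ultimately show ?thesis using assms by simp
qed

section \<open>Closure of q-polynomials under sums, composition and inversion\<close>

text \<open>A property of functions, so that composites and inverses can be formed without computing
  their coefficients.\<close>

definition is_linearized :: "('a \<Rightarrow> 'a) \<Rightarrow> bool" where
  "is_linearized f \<longleftrightarrow> (\<exists>a. f = linearized q n a)"

lemma is_linearized_power_q: "is_linearized (\<lambda>x. x ^ q ^ i)"
proof -
  have "(\<lambda>x::'a. x ^ q ^ i) = linearized q n (\<lambda>m. if m = i mod n then 1 else 0)"
    using n_pos by (simp add: fun_eq_iff linearized_def if_distrib[of "\<lambda>c. c * _"] power_q_mod cong: if_cong)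
  then show ?thesis unfolding is_linearized_def by blast
qed

lemma is_linearized_add:
  assumes "is_linearized f" "is_linearized g"
  shows "is_linearized (\<lambda>x. f x + g x)"
proof -
  obtain a b where "f = linearized q n a" "g = linearized q n b"
    using assms unfolding is_linearized_def by blast
  then have "(\<lambda>x. f x + g x) = linearized q n (\<lambda>i. a i + b i)"
    by (simp add: fun_eq_iff linearized_def distrib_right sum.distrib)
  then show ?thesis unfolding is_linearized_def by blast
qed

lemma is_linearized_cmult:
  assumes "is_linearized f"
  shows "is_linearized (\<lambda>x. c * f x)"
proof -
  obtain a where "f = linearized q n a"
    using assms unfolding is_linearized_def by blast
  then have "(\<lambda>x. c * f x) = linearized q n (\<lambda>i. c * a i)"
    by (simp add: fun_eq_iff linearized_def sum_distrib_left mult.assoc)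
  then show ?thesis unfolding is_linearized_def by blast
qed

lemma is_linearized_id: "is_linearized (\<lambda>x. x)"
  using is_linearized_power_q[of 0] by simp

lemma is_linearized_sum:
  assumes "\<And>i. i \<in> I \<Longrightarrow> is_linearized (f i)"
  shows "is_linearized (\<lambda>x. \<Sum>i\<in>I. f i x)"
proof -
  have zero: "is_linearized (\<lambda>x. 0)"
    using is_linearized_cmult[OF is_linearized_id, of 0] by simp
  show ?thesis
    using assms
    by (induction I rule: infinite_finite_induct) (auto intro: is_linearized_add zero)
qed

lemma is_linearized_power:
  assumes "is_linearized f"
  shows "is_linearized (\<lambda>x. f x ^ q ^ j)"
proof -
  obtain a where "f = linearized q n a"
    using assms unfolding is_linearized_def by blast
  then have "(\<lambda>x. f x ^ q ^ j) = (\<lambda>x. \<Sum>i<n. a i ^ q ^ j * x ^ q ^ ((i + j) mod n))"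
    by (simp add: fun_eq_iff linearized_def sum_power_q power_mult_distrib power_q_power_q)
  then show ?thesis
    by (simp only:) (intro is_linearized_sum is_linearized_cmult is_linearized_power_q)
qed

lemma is_linearized_comp:
  assumes "is_linearized f" "is_linearized g"
  shows "is_linearized (f \<circ> g)"
proof -
  obtain a where "f = linearized q n a"
    using assms unfolding is_linearized_def by blast
  then have "f \<circ> g = (\<lambda>x. \<Sum>i<n. a i * g x ^ q ^ i)"
    by (simp add: fun_eq_iff linearized_def)
  then show ?thesis
    using assms(2) by (simp only:) (intro is_linearized_sum is_linearized_cmult is_linearized_power)
qed

text \<open>On a finite set the inverse of a permutation is one of its iterates.\<close>

lemma is_linearized_right_inverse:
  assumes "is_linearized f" "bij f"
  shows "\<exists>g. is_linearized g \<and> f \<circ> g = id"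
proof -
  have pow: "is_linearized (f ^^ k)" for k
    by (induction k) (simp_all add: id_def is_linearized_id is_linearized_comp[OF assms(1)] del: o_apply)
  have "permutation f"
    using assms(2) by (simp add: permutation)
  then obtain k where k: "f ^^ k = id" "0 < k" by (rule permutation_is_nilpotent)
  then have "f \<circ> f ^^ (k - 1) = id" by (metis Suc_diff_1 funpow.simps(2))
  then show ?thesis using pow by blast
qed

end

section \<open>Semilinear maps acting on points of the projective line\<close>

lemma field_automorphism_0_1_power:
  fixes \<sigma> :: "'a::field \<Rightarrow> 'a"
  assumes "field_automorphism \<sigma>"
  shows "\<sigma> 0 = 0" "\<sigma> 1 = 1" "\<sigma> (x ^ k) = \<sigma> x ^ k"
proof -
  have add: "\<sigma> (x + y) = \<sigma> x + \<sigma> y" and mult: "\<sigma> (x * y) = \<sigma> x * \<sigma> y" and inj: "inj \<sigma>" for x y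
    using assms by (auto simp: field_automorphism_def bij_is_inj)
  show 0: "\<sigma> 0 = 0" using add[of 0 0] by (metis add_0 add_cancel_right_right)
  have "\<sigma> 1 \<noteq> 0" using 0 inj by (metis inj_eq zero_neq_one)
  then show 1: "\<sigma> 1 = 1" using mult[of 1 1] by simp
  show "\<sigma> (x ^ k) = \<sigma> x ^ k"
    by (induction k) (simp_all add: 1 mult)
qed

lemma GammaL_inverse:
  fixes T :: "'a::field ^ 'n \<Rightarrow> 'a ^ 'n"
  assumes "T \<in> GammaL"
  obtains T' where "T' \<in> GammaL" "T' \<circ> T = id"
proof -
  obtain \<sigma> where T: "bij T" "\<And>u v. T (u + v) = T u + T v"
    and \<sigma>: "field_automorphism \<sigma>" "\<And>c v. T (c *s v) = \<sigma> c *s T v"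
    using assms unfolding GammaL_def by blast
  have \<sigma>': "bij \<sigma>" "\<And>x y. \<sigma> (x + y) = \<sigma> x + \<sigma> y" "\<And>x y. \<sigma> (x * y) = \<sigma> x * \<sigma> y"
    using \<sigma>(1) by (auto simp: field_automorphism_def)
  define T' where "T' = inv_into UNIV T"
  define \<tau> where "\<tau> = inv_into UNIV \<sigma>"
  have TT: "T (T' v) = v" "T' (T v) = v" for v
    using T(1) by (simp_all add: T'_def bij_is_surj bij_is_inj surj_f_inv_f)
  have ST: "\<sigma> (\<tau> c) = c" "\<tau> (\<sigma> c) = c" for c
    using \<sigma>'(1) by (simp_all add: \<tau>_def bij_is_surj bij_is_inj surj_f_inv_f)
  have "field_automorphism \<tau>"
    unfolding field_automorphism_def
  proof (intro conjI allI)
    show "bij \<tau>" using \<sigma>'(1) unfolding \<tau>_def by (rule bij_imp_bij_inv)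
    show "\<tau> (x + y) = \<tau> x + \<tau> y" "\<tau> (x * y) = \<tau> x * \<tau> y" for x y
      by (metis ST \<sigma>'(2)) (metis ST \<sigma>'(3))
  qed
  moreover have "bij T'" using T(1) unfolding T'_def by (rule bij_imp_bij_inv)
  moreover have "T' (u + v) = T' u + T' v" for u v by (metis TT T(2))
  moreover have "T' (c *s v) = \<tau> c *s T' v" for c v by (metis TT ST \<sigma>(2))
  ultimately have "T' \<in> GammaL" unfolding GammaL_def by blast
  moreover have "T' \<circ> T = id" by (simp add: fun_eq_iff TT)
  ultimately show ?thesis by (rule that)
qed

lemma PGammaL_equivalent_iff:
  assumes "X \<subseteq> proj_points"
  shows "PGammaL_equivalent X Y \<longleftrightarrow> (\<exists>T\<in>GammaL. (`) T ` X = Y)"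
proof -
  have eq: "restrict ((`) T) proj_points ` X = (`) T ` X" for T
    using assms by (intro image_cong) auto
  show ?thesis by (simp only: PGammaL_equivalent_def PGammaL_def bex_simps(7) eq)
qed

text \<open>Needed because the coefficient computation starts from a map of the set of
  \<open>g1\<close> onto that of \<open>g2\<close>, the opposite direction to the one in the
  theorem.\<close>

lemma PGammaL_equivalent_sym:
  assumes "X \<subseteq> proj_points" "Y \<subseteq> proj_points" "PGammaL_equivalent X Y"
  shows "PGammaL_equivalent Y X"
proof -
  obtain T where T: "T \<in> GammaL" "(`) T ` X = Y"
    using assms(3) unfolding PGammaL_equivalent_iff[OF assms(1)] by blast
  obtain T' where T': "T' \<in> GammaL" "T' \<circ> T = id"
    using GammaL_inverse[OF T(1)] .
  have "(`) T' ` Y = (\<lambda>A. (T' \<circ> T) ` A) ` X"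
    by (simp add: T(2)[symmetric] image_image image_comp)
  then have "(`) T' ` Y = X" using T'(2) by simp
  then show ?thesis
    using T'(1) unfolding PGammaL_equivalent_iff[OF assms(2)] by blast
qed

lemma linear_set_subset_proj_points: "linear_set f \<subseteq> proj_points"
proof -
  have "vector [x, y] \<noteq> (0 :: 'a ^ 2)" if "x \<noteq> 0" for x y :: "'a::field"
    using that by (metis vector_2(1) zero_index)
  then show ?thesis by (auto simp: linear_set_def proj_points_def)
qed

lemma GammaL_image_span:
  fixes T :: "'a::field ^ 'n \<Rightarrow> 'a ^ 'n"
  assumes "surj \<sigma>" "\<And>c v. T (c *s v) = \<sigma> c *s T v"
  shows "T ` vec.span {v} = vec.span {T v}"
proof -
  have "T ` vec.span {v} = (\<lambda>c. c *s T v) ` range \<sigma>"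
    by (simp add: vec.span_singleton image_image assms(2))
  then show ?thesis using assms(1) by (simp add: vec.span_singleton)
qed

lemma span_vector_2_eq_imp:
  fixes s t x y :: "'a::field"
  assumes "vec.span {vector [s, t] :: 'a ^ 2} = vec.span {vector [x, y]}" "x \<noteq> 0"
  shows "s \<noteq> 0" "t / s = y / x"
proof -
  have "(vector [x, y] :: 'a ^ 2) \<in> vec.span {vector [s, t]}"
    unfolding assms(1) by (intro vec.span_base) simp
  then obtain c where "(vector [x, y] :: 'a ^ 2) = c *s vector [s, t]"
    by (auto simp: vec.span_singleton)
  then have "x = c * s" "y = c * t"
    by (simp_all add: vec_eq_iff forall_2)
  then show "s \<noteq> 0" "t / s = y / x" using assms(2) by auto
qed

text \<open>The point with first coordinate 0 is not in a set \<open>linear_set g\<close>, and every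
  other point is determined by its slope.\<close>

lemma linear_set_eq_imp_quotients_eq:
  fixes u v g :: "'a::field \<Rightarrow> 'a"
  assumes "{vec.span {vector [u x, v x]} |x. x \<noteq> 0} = linear_set g"
  shows "\<And>x. x \<noteq> 0 \<Longrightarrow> u x \<noteq> 0"
    and "(\<lambda>x. v x / u x) ` (-{0}) = (\<lambda>x. g x / x) ` (-{0})"
proof -
  have l: "\<exists>y. y \<noteq> 0 \<and> u x \<noteq> 0 \<and> v x / u x = g y / y" if "x \<noteq> 0" for x
  proof -
    have "vec.span {vector [u x, v x]} \<in> linear_set g" using that assms by blast
    then obtain y where "y \<noteq> 0" "vec.span {vector [u x, v x] :: 'a ^ 2} = vec.span {vector [y, g y]}"
      by (auto simp: linear_set_def)
    then show ?thesis using span_vector_2_eq_imp by blast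
  qed
  have r: "\<exists>x. x \<noteq> 0 \<and> v x / u x = g y / y" if "y \<noteq> 0" for y
  proof -
    have "vec.span {vector [y, g y] :: 'a ^ 2} \<in> {vec.span {vector [u x, v x]} |x. x \<noteq> 0}"
      unfolding assms using that by (auto simp: linear_set_def)
    then obtain x where "x \<noteq> 0" "vec.span {vector [u x, v x] :: 'a ^ 2} = vec.span {vector [y, g y]}"
      by blast
    then show ?thesis using span_vector_2_eq_imp that by blast
  qed
  show "\<And>x. x \<noteq> 0 \<Longrightarrow> u x \<noteq> 0" using l by blast
  show "(\<lambda>x. v x / u x) ` (-{0}) = (\<lambda>x. g x / x) ` (-{0})"
  proof (intro equalityI subsetI)
    fix z assume "z \<in> (\<lambda>x. v x / u x) ` (-{0})"
    then show "z \<in> (\<lambda>x. g x / x) ` (-{0})" using l by force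
  next
    fix z assume "z \<in> (\<lambda>x. g x / x) ` (-{0})"
    then show "z \<in> (\<lambda>x. v x / u x) ` (-{0})" using r by force
  qed
qed

text \<open>The columns of the matrix of \<open>T\<close> are the images of the unit vectors. The
  second column is nonzero because \<open>T\<close> is injective.\<close>

lemma GammaL_image_linear_set:
  fixes T :: "'a::field ^ 2 \<Rightarrow> 'a ^ 2"
  assumes "T \<in> GammaL"
  obtains \<sigma> \<alpha> \<beta> \<gamma> \<xi> where "field_automorphism \<sigma>"
    "\<forall>f. (`) T ` linear_set f =
      {vec.span {vector [\<alpha> * \<sigma> x + \<beta> * \<sigma> (f x), \<gamma> * \<sigma> x + \<xi> * \<sigma> (f x)]} |x. x \<noteq> 0}"
    "(\<beta>, \<xi>) \<noteq> (0, 0)"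
proof -
  obtain \<sigma> where T: "bij T" "\<And>u v. T (u + v) = T u + T v"
    and \<sigma>: "field_automorphism \<sigma>" "\<And>c v. T (c *s v) = \<sigma> c *s T v"
    using assms unfolding GammaL_def by blast
  have surj: "surj \<sigma>" using \<sigma>(1) by (auto simp: field_automorphism_def bij_is_surj)
  define e1 e2 :: "'a ^ 2" where "e1 = vector [1, 0]" and "e2 = vector [0, 1]"
  define \<alpha> \<beta> \<gamma> \<xi> where "\<alpha> = T e1 $ 1" and "\<beta> = T e2 $ 1" and "\<gamma> = T e1 $ 2" and "\<xi> = T e2 $ 2"
  have "vector [x, y] = x *s e1 + y *s e2" for x y
    by (simp add: vec_eq_iff forall_2 e1_def e2_def)
  then have "T (vector [x, y]) = \<sigma> x *s T e1 + \<sigma> y *s T e2" for x y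
    by (simp only: T(2) \<sigma>(2))
  then have "T (vector [x, y]) = vector [\<alpha> * \<sigma> x + \<beta> * \<sigma> y, \<gamma> * \<sigma> x + \<xi> * \<sigma> y]" for x y
    by (simp add: vec_eq_iff forall_2 \<alpha>_def \<beta>_def \<gamma>_def \<xi>_def mult.commute)
  then have img: "(`) T ` linear_set f =
      {vec.span {vector [\<alpha> * \<sigma> x + \<beta> * \<sigma> (f x), \<gamma> * \<sigma> x + \<xi> * \<sigma> (f x)]} |x. x \<noteq> 0}" for f
    using GammaL_image_span[of \<sigma> T, OF surj \<sigma>(2)]
    by (auto simp: linear_set_def image_iff) (metis (no_types, lifting))+
  have nz: "(\<beta>, \<xi>) \<noteq> (0, 0)"
  proof
    assume "(\<beta>, \<xi>) = (0, 0)"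
    then have "T e2 = 0" by (simp add: vec_eq_iff forall_2 \<beta>_def \<xi>_def)
    moreover have "T 0 = 0" using T(2)[of 0 0] by simp
    ultimately have "e2 = 0" using T(1) by (metis bij_is_inj injD)
    then have "e2 $ 2 = 0" by simp
    then show False by (simp add: e2_def)
  qed
  show ?thesis
    by (rule that[OF \<sigma>(1) allI[OF img] nz])
qed

section \<open>Norms and moments in degree five\<close>

lemma normq_mult: "normq q (x * y) = normq q x * normq q y"
  by (simp add: normq_def power_mult_distrib)

lemma normq_eq_0_iff: "normq q x = 0 \<longleftrightarrow> x = 0"
  by (auto simp: normq_def)

lemma lessThan_5: "{..<5::nat} = {0, 1, 2, 3, 4}"
  by auto

locale quintic_extension = finite_extension q 5 ty for q and ty :: "'a::finite_field itself"
begin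

lemma normq_power_q: "normq q ((x :: 'a) ^ q ^ i) = normq q x"
proof (induction i)
  case (Suc i)
  have "y ^ q ^ 5 = y" for y :: 'a
    using finite_field_power_card_eq_same[of y] by (simp add: card_UNIV)
  then have "normq q (y ^ q) = normq q y" for y :: 'a
    by (simp add: normq_def power_add power_mult_distrib mult_ac eval_nat_numeral flip: power_mult)
  from this[of "x ^ q ^ i"] show ?case using Suc by (simp add: mult.commute flip: power_mult)
qed simp

lemma normq_conv_prod: "normq q (x :: 'a) = (\<Prod>j<5. x ^ q ^ j)"
  by (simp add: lessThan_5 normq_def power_add)

lemma linearized_5: "linearized q 5 a (x :: 'a) =
    a 0 * x + a 1 * x ^ q + a 2 * x ^ q ^ 2 + a 3 * x ^ q ^ 3 + a 4 * x ^ q ^ 4"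
  by (simp add: linearized_def lessThan_5)

lemma g2_conv_linearized: "g2 q (\<delta> :: 'a) = linearized q 5 ((\<lambda>_. 0)(2 := \<delta>, 3 := 1))"
  by (simp add: fun_eq_iff linearized_5 g2_def)

lemma is_linearized_g1: "is_linearized (g1 q (\<mu> :: 'a))"
proof -
  have "g1 q \<mu> = linearized q 5 ((\<lambda>_. 0)(1 := \<mu>, 4 := 1))"
    by (simp add: fun_eq_iff linearized_5 g1_def)
  then show ?thesis unfolding is_linearized_def by blast
qed

text \<open>A nonzero term needs \<pi>(j) - j to be 2 or 3 modulo 5 for every j. Only the two
  rotations do this, and each contributes the norm of one coefficient.\<close>

lemma sum_permutes_5_eq:
  fixes a :: "nat \<Rightarrow> 'a"
  assumes "a 0 = 0" "a 1 = 0" "a 4 = 0"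
  shows "(\<Sum>\<pi> | \<pi> permutes {..<5}. \<Prod>j<5. a ((\<pi> j + 5 - j) mod 5) ^ q ^ j) =
    normq q (a 2) + normq q (a 3)"
proof -
  define \<rho> :: "nat \<Rightarrow> nat \<Rightarrow> nat" where "\<rho> k j = (if j < 5 then (j + k) mod 5 else j)" for k j
  have perm: "\<rho> k permutes {..<5}" for k
  proof (rule bij_imp_permutes)
    have "inj_on (\<rho> k) {..<5}"
    proof (rule inj_onI)
      fix i j assume "i \<in> {..<5}" "j \<in> {..<5}" "\<rho> k i = \<rho> k j"
      then have "[i + k = j + k] (mod 5)" "i < 5" "j < 5" by (simp_all add: \<rho>_def cong_def)
      then show "i = j" using cong_less_modulus_unique_nat by (simp add: cong_add_rcancel_nat)
    qed
    moreover have "\<rho> k ` {..<5} \<subseteq> {..<5}" by (auto simp: \<rho>_def)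
    ultimately show "bij_betw (\<rho> k) {..<5} {..<5}"
      by (simp add: bij_betw_def endo_inj_surj)
  qed (simp add: \<rho>_def)
  have "(\<Sum>\<pi> | \<pi> permutes {..<5}. \<Prod>j<5. a ((\<pi> j + 5 - j) mod 5) ^ q ^ j) =
      (\<Sum>\<pi>\<in>{\<rho> 2, \<rho> 3}. \<Prod>j<5. a ((\<pi> j + 5 - j) mod 5) ^ q ^ j)"
  proof (rule sum.mono_neutral_right)
    show "\<forall>\<pi>\<in>{\<pi>. \<pi> permutes {..<5}} - {\<rho> 2, \<rho> 3}. (\<Prod>j<5. a ((\<pi> j + 5 - j) mod 5) ^ q ^ j) = 0"
    proof (rule ballI, rule ccontr)
      fix \<pi> assume \<pi>: "\<pi> \<in> {\<pi>. \<pi> permutes {..<5::nat}} - {\<rho> 2, \<rho> 3}"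
        and nz: "(\<Prod>j<5. a ((\<pi> j + 5 - j) mod 5) ^ q ^ j) \<noteq> 0"
      have perm: "\<pi> permutes {..<5}" using \<pi> by simp
      have lt5: "j < 5 \<longleftrightarrow> j = 0 \<or> j = 1 \<or> j = 2 \<or> j = 3 \<or> j = 4" for j :: nat
        by linarith
      have step: "\<pi> j = (j + 2) mod 5 \<or> \<pi> j = (j + 3) mod 5" if "j < 5" for j
      proof -
        have "\<pi> j < 5" using permutes_in_image[OF perm, of j] that by simp
        with that have cases: "j < 5" "\<pi> j < 5" by simp_all
        have "a ((\<pi> j + 5 - j) mod 5) \<noteq> 0"
          using nz that q_ge_2 by (auto simp: zero_power)
        then have "(\<pi> j + 5 - j) mod 5 \<notin> {0, 1, 4}"
          using assms by (metis empty_iff insert_iff)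
        with cases show ?thesis unfolding lt5 by (elim disjE) simp_all
      qed
      have inj: "\<pi> i \<noteq> \<pi> j" if "i \<noteq> j" for i j
        using permutes_inj[OF perm] that by (simp add: inj_eq)
      \<comment> \<open>Shift 3 at j and shift 2 at j + 1 would both hit j + 3. So shift 3
        propagates around the cycle, and the shift is constant.\<close>
      have ne: "\<pi> 0 \<noteq> \<pi> 1" "\<pi> 1 \<noteq> \<pi> 2" "\<pi> 2 \<noteq> \<pi> 3" "\<pi> 3 \<noteq> \<pi> 4" "\<pi> 4 \<noteq> \<pi> 0"
        by (simp_all add: inj)
      have cases: "\<pi> 0 = 2 \<or> \<pi> 0 = 3" "\<pi> 1 = 3 \<or> \<pi> 1 = 4" "\<pi> 2 = 4 \<or> \<pi> 2 = 0"
        "\<pi> 3 = 0 \<or> \<pi> 3 = 1" "\<pi> 4 = 1 \<or> \<pi> 4 = 2"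
        using step[of 0] step[of 1] step[of 2] step[of 3] step[of 4] by (simp_all add: numeral_2_eq_2)
      have "(\<pi> 0 = 2 \<and> \<pi> 1 = 3 \<and> \<pi> 2 = 4 \<and> \<pi> 3 = 0 \<and> \<pi> 4 = 1) \<or>
          (\<pi> 0 = 3 \<and> \<pi> 1 = 4 \<and> \<pi> 2 = 0 \<and> \<pi> 3 = 1 \<and> \<pi> 4 = 2)"
        using cases ne by (elim disjE) simp_all
      then have "(\<forall>j<5. \<pi> j = (j + 2) mod 5) \<or> (\<forall>j<5. \<pi> j = (j + 3) mod 5)"
        unfolding lt5 by (elim disjE) (simp_all add: numeral_2_eq_2)
      moreover have "\<pi> = \<rho> k" if "\<forall>j<5. \<pi> j = (j + k) mod 5" for k
      proof
        fix j show "\<pi> j = \<rho> k j"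
          using that permutes_not_in[OF perm, of j] by (simp add: \<rho>_def)
      qed
      ultimately have "\<pi> = \<rho> 2 \<or> \<pi> = \<rho> 3"
        by blast
      then show False using \<pi> by simp
    qed
  qed (use perm in \<open>auto simp: finite_permutations\<close>)
  moreover have "\<rho> 2 \<noteq> \<rho> 3" by (auto simp: fun_eq_iff \<rho>_def intro!: exI[of _ 0])
  ultimately show ?thesis
    by (simp add: normq_conv_prod lessThan_5 \<rho>_def flip: numeral_2_eq_2)
qed

text \<open>Compares the moments for \<open>S = {0}, {0, 1}, {0, 2}, {0, 1, 2}\<close> and \<open>{0, \<dots>, 4}\<close>. The last one
  gives \<open>N(a\<^sub>2) + N(a\<^sub>3) = N(\<delta>) + 1\<close>, where \<open>N(\<delta>) = N(a\<^sub>2) N(a\<^sub>3)\<close>.\<close>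

lemma quotients_eq_g2_imp:
  fixes a :: "nat \<Rightarrow> 'a"
  assumes eq: "(\<lambda>x. linearized q 5 a x / x) ` (-{0}) = (\<lambda>x. g2 q \<delta> x / x) ` (-{0})"
    and "\<delta> \<noteq> 0"
  shows "a 0 = 0" "a 1 = 0" "a 4 = 0" "a 2 * a 3 ^ q ^ 2 = \<delta>"
    and "normq q (a 2) = 1 \<or> normq q (a 3) = 1"
proof -
  define b :: "nat \<Rightarrow> 'a" where "b = (\<lambda>_. 0)(2 := \<delta>, 3 := 1)"
  define M where "M c S = (\<Sum>\<pi> | \<pi> permutes S. \<Prod>j\<in>S. c ((\<pi> j + 5 - j) mod 5) ^ q ^ j)"
    for c :: "nat \<Rightarrow> 'a" and S
  have M: "M a S = M b S" if "S \<subseteq> {..<5}" "S \<noteq> {}" for S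
    using sum_permutes_eq_if_quotients_eq[of a b S] eq that
    by (simp add: M_def b_def g2_conv_linearized)
  have q: "q > 0" using q_ge_2 by simp
  have M0: "M c {0} = c 0" for c
    by (simp add: M_def permutes_sing)
  show a0: "a 0 = 0"
    using M[of "{0}"] by (simp add: M0 b_def)
  \<comment> \<open>As \<open>c 0 = 0\<close>, the identity contributes nothing and only the
    transposition of 0 and k is left.\<close>
  have M2: "M c {0, k} = c k * c (5 - k) ^ q ^ k" if "c 0 = 0" "0 < k" "k < 5" for c k
    using that q by (simp add: M_def sum_over_permutations_insert permutes_sing transpose_def)
  have a14: "a 1 * a 4 ^ q = 0"
    using M[of "{0, 1}"] a0 M2[of a 1] M2[of b 1] by (simp add: b_def)
  show a23: "a 2 * a 3 ^ q ^ 2 = \<delta>"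
    using M[of "{0, 2}"] a0 M2[of a 2] M2[of b 2] by (simp add: b_def)
  then have nz: "a 2 \<noteq> 0" "a 3 \<noteq> 0" using assms(2) q by auto
  \<comment> \<open>Permutations with a fixed point drop out, which leaves the two 3-cycles.\<close>
  have M3: "M c {0, 1, 2} = c 1 * c 1 ^ q * c 3 ^ q ^ 2 + c 2 * c 4 ^ q * c 4 ^ q ^ 2" if "c 0 = 0" for c
    using that q by (simp add: M_def sum_over_permutations_insert permutes_sing transpose_def mult_ac power_0_left)
  have "a 1 * a 1 ^ q * a 3 ^ q ^ 2 + a 2 * a 4 ^ q * a 4 ^ q ^ 2 = 0"
    using M[of "{0, 1, 2}"] a0 M3[of a] M3[of b] q by (simp add: b_def)
  \<comment> \<open>By \<open>a14\<close> one of \<open>a 1\<close> and \<open>a 4\<close> is 0, so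
    one summand vanishes. Then so does the other, and as \<open>a 2\<close> and \<open>a 3\<close>
    are nonzero, both \<open>a 1\<close> and \<open>a 4\<close> are 0.\<close>
  then show a1: "a 1 = 0" and a4: "a 4 = 0"
    using a14 nz q by (auto simp: power_0_left)
  have "normq q (a 2) + normq q (a 3) = normq q (b 2) + normq q (b 3)"
    using M[of "{..<5}"] lessThan_empty_iff[of "5 :: nat"] sum_permutes_5_eq[of a] sum_permutes_5_eq[of b] a0 a1 a4
    by (simp add: M_def b_def)
  also have "\<dots> = normq q \<delta> + 1" by (simp add: b_def normq_def)
  also have "normq q \<delta> = normq q (a 2) * normq q (a 3)"
    by (simp add: normq_mult normq_power_q flip: a23)
  finally have "(normq q (a 2) - 1) * (normq q (a 3) - 1) = 0"
    by (simp add: algebra_simps)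
  then show "normq q (a 2) = 1 \<or> normq q (a 3) = 1" by simp
qed

section \<open>Comparison of coefficients and the norm of \<delta>\<close>

text \<open>The coefficients at q-degrees 1 and 4 eliminate \<xi> and give N(a) = N(\<mu>)^2 N(b).
  Those at 2 and 3, after taking norms and multiplying, eliminate \<alpha> and \<beta> and give
  N(a)^2 N(\<mu>) = N(b)^2. Together they yield N(\<mu>)^5 = 1.\<close>

lemma binomial_comp_g1_imp:
  fixes a b \<alpha> \<beta> \<gamma> \<xi> \<mu> :: 'a
  assumes nz: "a \<noteq> 0" "b \<noteq> 0" "\<mu> \<noteq> 0" "(\<beta>, \<xi>) \<noteq> (0, 0)"
    and eq: "\<And>x. a * (\<alpha> * x + \<beta> * g1 q \<mu> x) ^ q ^ 2 + b * (\<alpha> * x + \<beta> * g1 q \<mu> x) ^ q ^ 3 =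
      \<gamma> * x + \<xi> * g1 q \<mu> x"
  shows "normq q \<mu> ^ 5 = 1" "normq q a = normq q \<mu> ^ 2 * normq q b"
proof -
  \<comment> \<open>The coefficients of the left side of \<open>eq\<close> minus its right side,
    with exponents reduced by x ^ (q ^ 5) = x.\<close>
  define c :: "nat \<Rightarrow> 'a" where "c = (\<lambda>_. 0)(0 := - \<gamma>, 1 := a * \<beta> ^ q ^ 2 - \<xi> * \<mu>,
    2 := a * \<alpha> ^ q ^ 2 + b * \<beta> ^ q ^ 3, 3 := a * (\<beta> * \<mu>) ^ q ^ 2 + b * \<alpha> ^ q ^ 3,
    4 := b * (\<beta> * \<mu>) ^ q ^ 3 - \<xi>)"
  have "linearized q 5 c x = 0" for x
  proof -
    have p: "(x ^ q) ^ q ^ 2 = x ^ q ^ 3" "(x ^ q) ^ q ^ 3 = x ^ q ^ 4"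
      "(x ^ q ^ 4) ^ q ^ 2 = x ^ q" "(x ^ q ^ 4) ^ q ^ 3 = x ^ q ^ 2"
      using power_q_power_q[of x 1 2] power_q_power_q[of x 1 3]
        power_q_power_q[of x 4 2] power_q_power_q[of x 4 3] by simp_all
    have "linearized q 5 c x = a * (\<alpha> * x + \<beta> * g1 q \<mu> x) ^ q ^ 2 +
        b * (\<alpha> * x + \<beta> * g1 q \<mu> x) ^ q ^ 3 - (\<gamma> * x + \<xi> * g1 q \<mu> x)"
      by (simp add: linearized_5 c_def g1_def add_power_q power_mult_distrib p algebra_simps)
    then show ?thesis using eq by simp
  qed
  then have c0: "c i = 0" if "i < 5" for i
    using linearized_zero_imp_coeff_zero that by blast
  have e1: "\<xi> * \<mu> = a * \<beta> ^ q ^ 2" using c0[of 1] by (simp add: c_def)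
  \<comment> \<open>The sign is kept as a factor -1 so that the norm can be taken multiplicatively.
    Its norm \<open>e\<close> later enters only through \<open>e * e = 1\<close>.\<close>
  have e2: "a * \<alpha> ^ q ^ 2 = -1 * (b * \<beta> ^ q ^ 3)" using c0[of 2] by (simp add: c_def eq_neg_iff_add_eq_0)
  have e3: "a * (\<beta> * \<mu>) ^ q ^ 2 = -1 * (b * \<alpha> ^ q ^ 3)" using c0[of 3] by (simp add: c_def eq_neg_iff_add_eq_0)
  have e4: "\<xi> = b * (\<beta> * \<mu>) ^ q ^ 3" using c0[of 4] by (simp add: c_def)
  have "q > 0" using q_ge_2 by simp
  then have \<beta>: "\<beta> \<noteq> 0" using e4 nz(4) by auto
  define A B m r s e where "A = normq q a" and "B = normq q b" and "m = normq q \<mu>"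
    and "r = normq q \<alpha>" and "s = normq q \<beta>" and "e = normq q (-1 :: 'a)"
  have nz': "A \<noteq> 0" "B \<noteq> 0" "m \<noteq> 0" "s \<noteq> 0"
    using nz \<beta> by (simp_all add: A_def B_def m_def s_def normq_eq_0_iff)
  have "B * s * m * m = A * s"
    using arg_cong[OF e1, of "normq q"] unfolding e4
    by (simp add: normq_mult normq_power_q A_def B_def m_def s_def mult_ac)
  then have AB: "A = m ^ 2 * B" using nz' by (simp add: power2_eq_square mult_ac)
  then show "normq q a = normq q \<mu> ^ 2 * normq q b" by (simp add: A_def B_def m_def)
  have n2: "A * r = e * (B * s)"
    using arg_cong[OF e2, of "normq q"]
    by (simp only: normq_mult normq_power_q A_def B_def m_def s_def r_def e_def)
  have n3: "A * (s * m) = e * (B * r)"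
    using arg_cong[OF e3, of "normq q"]
    by (simp only: normq_mult normq_power_q A_def B_def m_def s_def r_def e_def)
  have "e * e = 1" unfolding e_def by (simp add: normq_def flip: normq_mult)
  have "A * A * m * (r * s) = (A * r) * (A * (s * m))" by (simp add: mult_ac)
  also have "\<dots> = (e * e) * (B * B) * (r * s)" unfolding n2 n3 by (simp add: mult_ac)
  finally have "A * A * m * (r * s) = B * B * (r * s)" using \<open>e * e = 1\<close> by simp
  moreover have "r * s \<noteq> 0" using n3 nz' by auto
  ultimately have "A * A * m = B * B" by simp
  then have "m ^ 5 * (B * B) = B * B" unfolding AB by (simp add: eval_nat_numeral mult_ac)
  then show "normq q \<mu> ^ 5 = 1" using nz' by (simp add: m_def)
qed

lemma PGammaL_equivalent_g1_g2_imp: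
  fixes \<delta> \<mu> :: 'a
  assumes "\<delta> \<noteq> 0" "\<mu> \<noteq> 0" "PGammaL_equivalent (linear_set (g1 q \<mu>)) (linear_set (g2 q \<delta>))"
  shows "normq q \<delta> ^ 5 = 1"
proof -
  obtain T where T: "T \<in> GammaL" "(`) T ` linear_set (g1 q \<mu>) = linear_set (g2 q \<delta>)"
    using assms(3) unfolding PGammaL_equivalent_iff[OF linear_set_subset_proj_points] by blast
  obtain \<sigma> \<alpha> \<beta> \<gamma> \<xi> where \<sigma>: "field_automorphism \<sigma>"
    and img: "\<forall>f. (`) T ` linear_set f =
      {vec.span {vector [\<alpha> * \<sigma> x + \<beta> * \<sigma> (f x), \<gamma> * \<sigma> x + \<xi> * \<sigma> (f x)]} |x. x \<noteq> 0}"
    and nz: "(\<beta>, \<xi>) \<noteq> (0, 0)"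
    using GammaL_image_linear_set[OF T(1)] .
  have bij: "bij \<sigma>" and \<sigma>0: "\<sigma> 0 = 0"
    using \<sigma> field_automorphism_0_1_power(1) by (auto simp: field_automorphism_def)
  have nz0: "\<sigma> x \<noteq> 0 \<longleftrightarrow> x \<noteq> 0" for x
    using bij \<sigma>0 by (metis bij_is_inj inj_eq)
  \<comment> \<open>\<sigma> commutes with powers, so it carries \<open>g1\<close> with parameter
    \<mu> to \<open>g1\<close> with the conjugate parameter.\<close>
  define \<mu>' where "\<mu>' = \<sigma> \<mu>"
  have "\<mu>' \<noteq> 0" using assms(2) by (simp add: \<mu>'_def nz0)
  have g1: "\<sigma> (g1 q \<mu> x) = g1 q \<mu>' (\<sigma> x)" for x
    using \<sigma> by (simp add: g1_def \<mu>'_def field_automorphism_0_1_power field_automorphism_def)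
  define u v where "u x = \<alpha> * x + \<beta> * g1 q \<mu>' x" and "v x = \<gamma> * x + \<xi> * g1 q \<mu>' x" for x
  \<comment> \<open>\<sigma> permutes the nonzero elements, so it can be absorbed into the parameter
    x.\<close>
  have reindex: "{F (\<sigma> x) |x. x \<noteq> 0} = {F y |y. y \<noteq> 0}" for F :: "'a \<Rightarrow> ('a ^ 2) set"
  proof (intro equalityI subsetI)
    fix z assume "z \<in> {F y |y. y \<noteq> 0}"
    then obtain y where y: "y \<noteq> 0" "z = F y" by blast
    obtain x where "y = \<sigma> x" using bij by (metis bij_is_surj surjD)
    then show "z \<in> {F (\<sigma> x) |x. x \<noteq> 0}" using y nz0 by blast
  qed (use nz0 in blast)
  have "{vec.span {vector [u x, v x]} |x. x \<noteq> 0} = (`) T ` linear_set (g1 q \<mu>)"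
    unfolding img[rule_format] g1 u_def[symmetric] v_def[symmetric]
    by (rule reindex[symmetric])
  then have eq: "{vec.span {vector [u x, v x]} |x. x \<noteq> 0} = linear_set (g2 q \<delta>)"
    using T(2) by simp
  note quot = linear_set_eq_imp_quotients_eq[OF eq]
  have lin: "is_linearized u" "is_linearized v"
    unfolding u_def v_def
    by (intro is_linearized_add is_linearized_cmult is_linearized_id is_linearized_g1)+
  have u_add: "u (x + y) = u x + u y" for x y
    using lin(1) by (auto simp: is_linearized_def linearized_add)
  then have u0: "u 0 = 0" by (metis add_0 add_cancel_right_right)
  \<comment> \<open>The additive map \<open>u\<close> has trivial kernel, since no point of the
    image has first coordinate 0.\<close>
  have "inj u"
  proof (rule injI)
    fix x y assume "u x = u y"
    then have "u (x - y) = 0" using u_add[of "x - y" y] by simp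
    then show "x = y" using quot(1)[of "x - y"] by auto
  qed
  then have "bij u" by (simp add: bij_def finite_UNIV_inj_surj)
  obtain w where w: "is_linearized w" "u \<circ> w = id"
    using is_linearized_right_inverse[OF lin(1) \<open>bij u\<close>] by blast
  have uw: "u (w y) = y" for y using w(2) by (metis comp_apply id_apply)
  then have wu: "w (u x) = x" for x using \<open>inj u\<close> by (metis injD)
  obtain a where a: "v \<circ> w = linearized q 5 a"
    using is_linearized_comp[OF lin(2) w(1)] by (auto simp: is_linearized_def)
  have f: "linearized q 5 a (u x) = v x" for x
    by (simp add: wu flip: a)
  \<comment> \<open>Substituting y = u(x) turns the slopes v(x)/u(x) into quotients of the single
    q-polynomial \<open>v \<circ> w\<close>.\<close>
  have "-{0} = u ` (-{0})"
    using bij_image_Compl_eq[OF \<open>bij u\<close>, of "{0}"] u0 by simp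
  then have "(\<lambda>y. linearized q 5 a y / y) ` (-{0}) = (\<lambda>y. linearized q 5 a y / y) ` u ` (-{0})"
    by simp
  also have "\<dots> = (\<lambda>x. v x / u x) ` (-{0})" by (simp add: image_image f)
  also have "\<dots> = (\<lambda>x. g2 q \<delta> x / x) ` (-{0})" by (rule quot(2))
  finally have quot_eq: "(\<lambda>y. linearized q 5 a y / y) ` (-{0}) = (\<lambda>x. g2 q \<delta> x / x) ` (-{0})" .
  note coeffs = quotients_eq_g2_imp[OF quot_eq assms(1)]
  have nz_a: "a 2 \<noteq> 0" "a 3 \<noteq> 0"
    using coeffs(4) assms(1) q_ge_2 by auto
  have "a 2 * u x ^ q ^ 2 + a 3 * u x ^ q ^ 3 = v x" for x
    using f[of x] coeffs(1-3) by (simp add: linearized_5)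
  note norms = binomial_comp_g1_imp[OF nz_a \<open>\<mu>' \<noteq> 0\<close> nz this[unfolded u_def v_def]]
  have \<delta>: "normq q \<delta> = normq q (a 2) * normq q (a 3)"
    by (simp add: normq_mult normq_power_q flip: coeffs(4))
  \<comment> \<open>In the two cases below N(\<delta>) is the inverse of N(\<mu>')^2 or N(\<mu>')^2
    itself, hence a fifth root of unity.\<close>
  have m: "(normq q \<mu>' ^ 2) ^ 5 = 1"
    using norms(1) by (metis mult.commute power_mult power_one)
  from coeffs(5) show ?thesis
  proof
    assume "normq q (a 2) = 1"
    then have "normq q \<mu>' ^ 2 * normq q \<delta> = 1" using norms(2) \<delta> by simp
    then have "(normq q \<mu>' ^ 2) ^ 5 * normq q \<delta> ^ 5 = 1" by (metis power_mult_distrib power_one)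
    then show ?thesis using m by simp
  next
    assume "normq q (a 3) = 1"
    then show ?thesis using norms(2) \<delta> m by simp
  qed
qed

end

theorem theorem5p4:
  fixes q :: nat and \<delta> :: "'a::finite_field"
  assumes "primepow q"
    and "CARD('a) = q ^ 5"
    and "\<delta> \<noteq> 0"
    and "normq q \<delta> ^ 5 \<noteq> 1"
  shows "\<not> (\<exists>\<mu>::'a. \<mu> \<noteq> 0 \<and> normq q \<mu> \<notin> {0, 1} \<and>
           PGammaL_equivalent (linear_set (g2 q \<delta>)) (linear_set (g1 q \<mu>)))"
proof -
  interpret quintic_extension q "TYPE('a)"
    using assms(1,2) by unfold_locales
  show ?thesis
    using assms(3,4) PGammaL_equivalent_g1_g2_imp
      PGammaL_equivalent_sym[OF linear_set_subset_proj_points linear_set_subset_proj_points]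
    by blast
qed

end
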